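(* Let $(p_a,Q_a)$ and $(p_b,Q_b)$ be two equivalent Coxian phase-type (CPH) distributions of the same order $n$, with absorbing rate vectors $q_a=-Q_a\mathbb{1}$ and $q_b=-Q_b\mathbb{1}$. Then the absorbing rates from the first phase of the corresponding Markov chains are identical; that is, the first entries of the column vectors $q_a$ and $q_b$ are equal.
   Context: An $n$-CPH (Coxian phase-type) distribution of order $n$ is given by a pair $(p,Q)$ with initial row vector $p=(1,0,\dots,0)\in\mathbb{R}^n$ and $n\times n$ upper bidiagonal generator $Q$ whose diagonal entries are $Q_{ii}=-(\lambda_i+\mu_i)$ for $1\le i\le n-1$ and $Q_{nn}=-\mu_n$, whose superdiagonal entries are $Q_{i,i+1}=\lambda_i$ for $1\le i\le n-1$, and whose other entries are zero. Here $\lambda_i>0$ for $1\le i\le n-1$ and $\mu_i\ge 0$ for all $i$, with $\mu_n>0$; in particular all diagonal and superdiagonal entries of $Q$ are non-zero. The absorbing rate vector is $q=(\mu_1,\dots,\mu_n)^T=-Q\mathbb{1}$, where $\mathbb{1}$ is the column vector of ones, and the density is $f(t)=p e^{Qt}q$, $t\ge 0$. Two CPH distributions $(p_a,Q_a)$ and $(p_b,Q_b)$ of order $n$ are equivalent if their densities coincide: $p_ae^{Q_at}q_a=p_be^{Q_bt}q_b$ for all $t\ge 0$. *)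

theory Defs
  imports Complex_Main "Jordan_Normal_Form.Matrix"
begin

text \<open>
  Vectors and matrices are those of \<^theory>\<open>Jordan_Normal_Form.Matrix\<close>: the order \<open>n\<close> is an
  ordinary natural number, and indices start at 0.  Phase \<open>i\<close> of the Markov chain, for
  \<open>1 \<le> i \<le> n\<close>, has index \<open>i - 1\<close>.
\<close>

text \<open>
  The exponential of a square matrix, as the entrywise sum of the power series; the series
  converges by \<open>mat_exp_summable\<close> below.
\<close>

definition mat_exp :: "real mat \<Rightarrow> real mat" where
  "mat_exp A = mat (dim_row A) (dim_row A) (\<lambda>(i, j). \<Sum>k. (A ^\<^sub>m k) $$ (i, j) / fact k)"

definition coxian_generator :: "nat \<Rightarrow> (nat \<Rightarrow> real) \<Rightarrow> (nat \<Rightarrow> real) \<Rightarrow> real mat" where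
  "coxian_generator n lam mu = mat n n (\<lambda>(i, j).
     if j = i then (if Suc i < n then - (lam i + mu i) else - mu i)
     else if j = Suc i then lam i
     else 0)"

definition is_CPH :: "nat \<Rightarrow> real vec \<Rightarrow> real mat \<Rightarrow> bool" where
  "is_CPH n p Q \<longleftrightarrow>
     1 \<le> n \<and> p = unit_vec n 0 \<and>
     (\<exists>lam mu.
        (\<forall>i. Suc i < n \<longrightarrow> 0 < lam i) \<and>
        (\<forall>i<n. 0 \<le> mu i) \<and> 0 < mu (n - 1) \<and>
        Q = coxian_generator n lam mu)"

definition absorbing_rates :: "real mat \<Rightarrow> real vec" where
  "absorbing_rates Q = - (Q *\<^sub>v vec (dim_col Q) (\<lambda>_. 1))"

definition ph_density :: "real vec \<Rightarrow> real mat \<Rightarrow> real \<Rightarrow> real" where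
  "ph_density p Q t = p \<bullet> (mat_exp (t \<cdot>\<^sub>m Q) *\<^sub>v absorbing_rates Q)"

definition ph_equivalent :: "real vec \<Rightarrow> real mat \<Rightarrow> real vec \<Rightarrow> real mat \<Rightarrow> bool" where
  "ph_equivalent p_a Q_a p_b Q_b \<longleftrightarrow> (\<forall>t\<ge>0. ph_density p_a Q_a t = ph_density p_b Q_b t)"

lemma mat_exp_summable:
  fixes A :: "real mat"
  assumes A: "A \<in> carrier_mat n n" and i: "i < n" and j: "j < n"
  shows "summable (\<lambda>k. (A ^\<^sub>m k) $$ (i, j) / fact k)"
proof -
  define M where "M = (\<Sum>i<n. \<Sum>j<n. \<bar>A $$ (i, j)\<bar>)"
  have M: "\<bar>A $$ (i, j)\<bar> \<le> M" if "i < n" "j < n" for i j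
  proof -
    have "\<bar>A $$ (i, j)\<bar> \<le> (\<Sum>j<n. \<bar>A $$ (i, j)\<bar>)"
      using that by (intro member_le_sum) auto
    also have "\<dots> \<le> M"
      unfolding M_def using that by (intro member_le_sum[of i]) (auto intro: sum_nonneg)
    finally show ?thesis .
  qed
  have M0: "0 \<le> M" unfolding M_def by (intro sum_nonneg) auto
  have bound: "\<bar>(A ^\<^sub>m k) $$ (i, j)\<bar> \<le> (real n * M) ^ k" if "i < n" "j < n" for i j k
    using that
  proof (induction k arbitrary: i j)
    case 0
    then show ?case using A by auto
  next
    case (Suc k)
    have P: "A ^\<^sub>m k \<in> carrier_mat n n" using A by (rule pow_carrier_mat)
    have "(A ^\<^sub>m Suc k) $$ (i, j) = (\<Sum>l<n. (A ^\<^sub>m k) $$ (i, l) * A $$ (l, j))"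
      using A P Suc.prems by (auto simp: scalar_prod_def lessThan_atLeast0)
    also have "\<bar>\<dots>\<bar> \<le> (\<Sum>l<n. \<bar>(A ^\<^sub>m k) $$ (i, l)\<bar> * \<bar>A $$ (l, j)\<bar>)"
      by (rule order_trans[OF sum_abs]) (simp add: abs_mult)
    also have "\<dots> \<le> (\<Sum>l<n. (real n * M) ^ k * M)"
      using Suc M M0 by (intro sum_mono mult_mono) auto
    finally show ?case by (simp add: algebra_simps)
  qed
  have "summable (\<lambda>k. (real n * M) ^ k / fact k)"
    using summable_exp[of "real n * M"] by (simp add: divide_inverse mult.commute)
  then show ?thesis
    by (rule summable_comparison_test') (use bound[OF i j] in \<open>simp add: divide_right_mono\<close>)
qed

lemma absorbing_rates_coxian_generator:
  "absorbing_rates (coxian_generator n lam mu) = vec n mu"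
proof (rule eq_vecI)
  fix i assume "i < dim_vec (vec n mu)"
  then have i: "i < n" by simp
  let ?d = "if Suc i < n then - (lam i + mu i) else - mu i"
  have "absorbing_rates (coxian_generator n lam mu) $ i
      = - (\<Sum>j<n. coxian_generator n lam mu $$ (i, j))"
    using i by (simp add: absorbing_rates_def coxian_generator_def scalar_prod_def lessThan_atLeast0)
  also have "(\<Sum>j<n. coxian_generator n lam mu $$ (i, j))
      = (\<Sum>j<n. (if j = i then ?d else 0) + (if j = Suc i then lam i else 0))"
    using i by (intro sum.cong) (auto simp: coxian_generator_def)
  also have "\<dots> = - mu i"
    using i by (simp add: sum.distrib)
  finally show "absorbing_rates (coxian_generator n lam mu) $ i = vec n mu $ i"
    using i by simp
qed (simp add: absorbing_rates_def coxian_generator_def)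

end

theory Submission
  imports Defs
begin

text \<open>
  The rate of absorption from the first phase is the value of the density at time \<open>0\<close>: there
  \<open>exp (Q t)\<close> is the identity, and the initial vector is the first unit vector, so \<open>p e\<^sup>0 q\<close> is the
  first entry of \<open>q\<close>.  Equivalent distributions have the same density at time \<open>0\<close>, hence the same
  first absorbing rate.
\<close>

lemma mat_exp_zero: "mat_exp (0\<^sub>m n n) = 1\<^sub>m n"
proof (rule eq_matI)
  fix i j assume "i < dim_row (1\<^sub>m n)" and "j < dim_col (1\<^sub>m n)"
  then have ij: "i < n" "j < n" by simp_all
  have pow_Suc: "0\<^sub>m n n ^\<^sub>m Suc k = (0\<^sub>m n n :: real mat)" for k
    by (simp add: right_mult_zero_mat[OF pow_carrier_mat[OF zero_carrier_mat]])
  have "(\<Sum>k. (0\<^sub>m n n ^\<^sub>m k) $$ (i, j) / fact k)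
      = (\<Sum>k\<in>{0}. (0\<^sub>m n n ^\<^sub>m k) $$ (i, j) / fact k :: real)"
  proof (rule suminf_finite)
    fix k :: nat assume "k \<notin> {0}"
    then obtain l where "k = Suc l" by (cases k) auto
    then show "(0\<^sub>m n n ^\<^sub>m k) $$ (i, j) / fact k = (0 :: real)"
      using ij by (simp only: pow_Suc) simp
  qed simp
  then show "mat_exp (0\<^sub>m n n) $$ (i, j) = 1\<^sub>m n $$ (i, j)"
    using ij by (simp add: mat_exp_def)
qed (simp_all add: mat_exp_def)

lemma ph_density_unit_vec_at_0:
  assumes Q: "Q \<in> carrier_mat n n" and i: "i < n"
  shows "ph_density (unit_vec n i) Q 0 = absorbing_rates Q $ i"
proof -
  have q: "absorbing_rates Q \<in> carrier_vec n"
    using Q by (intro carrier_vecI) (simp add: absorbing_rates_def)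
  have "0 \<cdot>\<^sub>m Q = 0\<^sub>m n n"
    using Q by (intro eq_matI) auto
  then have "mat_exp (0 \<cdot>\<^sub>m Q) *\<^sub>v absorbing_rates Q = absorbing_rates Q"
    using q by (simp add: mat_exp_zero)
  then show ?thesis
    using q i by (simp add: ph_density_def scalar_prod_left_unit)
qed

lemma ph_density_CPH_at_0:
  assumes "is_CPH n p Q"
  shows "ph_density p Q 0 = absorbing_rates Q $ 0"
proof -
  have "p = unit_vec n 0" "0 < n" "Q \<in> carrier_mat n n"
    using assms by (auto simp: is_CPH_def coxian_generator_def)
  then show ?thesis
    using ph_density_unit_vec_at_0 by simp
qed

theorem corollary2:
  fixes n :: nat and p_a p_b :: "real vec" and Q_a Q_b :: "real mat"
  assumes "is_CPH n p_a Q_a" and "is_CPH n p_b Q_b"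
    and "ph_equivalent p_a Q_a p_b Q_b"
  shows "absorbing_rates Q_a $ 0 = absorbing_rates Q_b $ 0"
proof -
  have "ph_density p_a Q_a 0 = ph_density p_b Q_b 0"
    using assms(3) by (simp add: ph_equivalent_def)
  then show ?thesis
    by (simp only: ph_density_CPH_at_0[OF assms(1)] ph_density_CPH_at_0[OF assms(2)])
qed

end
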